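(* Let $\mathbb K$ be a field with $\mathrm{char}\,\mathbb K\ne2$. Then there are three orbits of $\Sigma_\beta$ on $\mathbb K^{2\times2}$, characterized by the rank of their members. Representatives for the orbits are thus $\begin{pmatrix}0&0\\0&0\end{pmatrix}$, $\begin{pmatrix}1&0\\0&0\end{pmatrix}$ and $\begin{pmatrix}1&0\\0&1\end{pmatrix}$. Each orbit of $\Sigma_\beta$ on $P$ is obtained by fusion of a conjugacy class (under $\mathrm{GL}_2(\mathbb K)$) with all its images under multiplication with nonzero scalars. These orbits are represented (exactly one element in each orbit) by the elements of the set $$\left\{\begin{pmatrix}0&0\\0&0\end{pmatrix}\right\}\cup\left\{\begin{pmatrix}0&-d\\1&0\end{pmatrix}\ \middle|\ d\in R_*\cup\{0\}\right\},$$ where $R_*$ is a set of representatives for the cosets in $\mathbb K^\times/\{s^2\mid s\in\mathbb K^\times\}$.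
   Context: For $x=\begin{pmatrix}a&b\\c&d\end{pmatrix}\in\mathbb K^{2\times2}$ let $\tilde x:=\begin{pmatrix}d&-b\\-c&a\end{pmatrix}$ be the adjugate (the standard involution of the split quaternion algebra $\mathbb K^{2\times2}$). $P:=\{x\in\mathbb K^{2\times2}\mid\mathrm{tr}(x)=0\}$, and $\beta=\beta_{\mathbb K^{2\times2}}\colon\mathbb K^{2\times2}\times\mathbb K^{2\times2}\to P$ is the alternating $\mathbb K$-bilinear map $\beta(x,y):=\tilde xy-\tilde yx$. $\Sigma_\beta$ is the group of all $\mathbb K$-linear bijections $\sigma$ of the $4$-dimensional space $V=\mathbb K^{2\times2}$ whose induced map on $V\wedge V$ leaves the kernel of $\hat\beta\colon V\wedge V\to P$, $v\wedge w\mapsto\beta(v,w)$, invariant; equivalently, those $\sigma$ for which there is a (unique) $\sigma'\in\mathrm{GL}(P)$ with $\sigma'(\beta(u,v))=\beta(\sigma(u),\sigma(v))$ for all $u,v\in V$. $\Sigma_\beta$ acts on $P$ via $\sigma\mapsto\sigma'$. *)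

theory Defs
  imports "HOL-Analysis.Analysis" "HOL-Algebra.Group_Action"
begin

section \<open>The vector space of matrices\<close>

definition mat_scale :: "'k::field \<Rightarrow> 'k^'n^'m \<Rightarrow> 'k^'n^'m" (infixr \<open>*m\<close> 75)
  where "c *m A = map_matrix ((*) c) A"

lemma mat_scale_nth [simp]: "(c *m A) $ i $ j = c * A $ i $ j"
  by (simp add: mat_scale_def)

interpretation mats: vector_space "mat_scale :: 'k::field \<Rightarrow> 'k^'n^'m \<Rightarrow> 'k^'n^'m"
  by unfold_locales (simp_all add: vec_eq_iff algebra_simps)

abbreviation mat2 :: "'k \<Rightarrow> 'k \<Rightarrow> 'k \<Rightarrow> 'k \<Rightarrow> 'k::zero^2^2"
  where "mat2 a b c d \<equiv> vector [vector [a, b], vector [c, d]]"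

lemma mat2_eta: "x = mat2 (x$1$1) (x$1$2) (x$2$1) (x$2$2)"
  by (simp add: vec_eq_iff forall_2)

definition adj2 :: "'k::field^2^2 \<Rightarrow> 'k^2^2"
  where "adj2 x = mat2 (x$2$2) (- (x$1$2)) (- (x$2$1)) (x$1$1)"

definition pure :: "('k::field^2^2) set"
  where "pure = {x. trace x = 0}"

definition beta :: "'k::field^2^2 \<Rightarrow> 'k^2^2 \<Rightarrow> 'k^2^2"
  where "beta x y = adj2 x ** y - adj2 y ** x"


section \<open>The exterior square\<close>

text \<open>With respect to the matrix units \<open>E p\<close> (\<open>p = (i, j)\<close>), the tensor square of the space \<open>V\<close>
  of 2-by-2 matrices is identified with the matrices indexed by pairs of positions: \<open>E p \<otimes> E q\<close> is
  the matrix unit at \<open>(p, q)\<close>.  The exterior square is the span of the tensors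
  \<open>u \<otimes> v - v \<otimes> u\<close>; over any field, \<open>u \<and> v \<mapsto> u \<otimes> v - v \<otimes> u\<close> identifies the quotient of
  \<open>V \<otimes> V\<close> by the span of all \<open>v \<otimes> v\<close> with it.\<close>

type_synonym 'k tensor2 = "'k^(2 \<times> 2)^(2 \<times> 2)"

definition unit_mat :: "2 \<times> 2 \<Rightarrow> 'k::field^2^2"
  where "unit_mat p = (\<chi> i j. if (i, j) = p then 1 else 0)"

definition tensor :: "'k::field^2^2 \<Rightarrow> 'k^2^2 \<Rightarrow> 'k tensor2"
  where "tensor u v = (\<chi> p q. u $ fst p $ snd p * v $ fst q $ snd q)"

definition wedge :: "'k::field^2^2 \<Rightarrow> 'k^2^2 \<Rightarrow> 'k tensor2"
  where "wedge u v = tensor u v - tensor v u"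

definition ext_square :: "'k::field tensor2 set"
  where "ext_square = mats.span {wedge u v | u v. True}"

text \<open>The linear map \<open>E p \<otimes> E q \<mapsto> adj2 (E p) ** E q\<close>, which restricts on the exterior square to
  the linear map induced by \<^const>\<open>beta\<close>; see \<open>beta_hat_wedge\<close>.\<close>

definition beta_hat :: "'k::field tensor2 \<Rightarrow> 'k^2^2"
  where "beta_hat A = (\<Sum>p\<in>UNIV. \<Sum>q\<in>UNIV. A $ p $ q *m (adj2 (unit_mat p) ** unit_mat q))"

text \<open>The map \<open>\<sigma> \<otimes> \<sigma>\<close>, which restricts to \<open>\<sigma> \<and> \<sigma>\<close> on the exterior square; see \<open>ext_map_wedge\<close>.\<close>

definition ext_map :: "('k::field^2^2 \<Rightarrow> 'k^2^2) \<Rightarrow> 'k tensor2 \<Rightarrow> 'k tensor2"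
  where "ext_map \<sigma> A = (\<Sum>p\<in>UNIV. \<Sum>q\<in>UNIV. A $ p $ q *m tensor (\<sigma> (unit_mat p)) (\<sigma> (unit_mat q)))"

definition ker_beta_hat :: "'k::field tensor2 set"
  where "ker_beta_hat = {A \<in> ext_square. beta_hat A = 0}"


section \<open>The group and its actions\<close>

definition Sigma_beta :: "('k::field^2^2 \<Rightarrow> 'k^2^2) set"
  where "Sigma_beta = {\<sigma>. Vector_Spaces.linear (*m) (*m) \<sigma> \<and> bij \<sigma> \<and>
                           ext_map \<sigma> ` ker_beta_hat = ker_beta_hat}"

definition Sigma_grp :: "('k::field^2^2 \<Rightarrow> 'k^2^2) monoid"
  where "Sigma_grp = \<lparr>carrier = Sigma_beta, mult = (\<circ>), one = id\<rparr>"

text \<open>As in \<^const>\<open>Bij\<close>, maps on the subspace are normalised to be \<open>undefined\<close> outside.\<close>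

definition GL_pure :: "('k::field^2^2 \<Rightarrow> 'k^2^2) set"
  where "GL_pure = {s \<in> Bij pure. (\<forall>x\<in>pure. \<forall>y\<in>pure. s (x + y) = s x + s y) \<and>
                                  (\<forall>c. \<forall>x\<in>pure. s (c *m x) = c *m s x)}"

definition induced :: "('k::field^2^2 \<Rightarrow> 'k^2^2) \<Rightarrow> 'k^2^2 \<Rightarrow> 'k^2^2"
  where "induced \<sigma> = (THE s. s \<in> GL_pure \<and> (\<forall>u v. s (beta u v) = beta (\<sigma> u) (\<sigma> v)))"

definition conj_class :: "'k::field^2^2 \<Rightarrow> ('k^2^2) set"
  where "conj_class x = {g ** x ** matrix_inv g | g. invertible g}"


section \<open>Square classes\<close>

definition square_class :: "'k::field \<Rightarrow> 'k set"
  where "square_class a = {a * s\<^sup>2 | s. s \<noteq> 0}"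

definition square_class_reps :: "'k::field set \<Rightarrow> bool"
  where "square_class_reps R \<longleftrightarrow> 0 \<notin> R \<and> (\<forall>a. a \<noteq> 0 \<longrightarrow> (\<exists>!r. r \<in> R \<and> r \<in> square_class a))"


section \<open>Consistency of the definitions\<close>

lemma sum_22: "(\<Sum>p\<in>(UNIV::(2 \<times> 2) set). f p) = f (1,1) + f (1,2) + (f (2,1) + f (2,2))"
proof -
  have "(\<Sum>p\<in>(UNIV::(2 \<times> 2) set). f p) = (\<Sum>i\<in>UNIV. \<Sum>j\<in>UNIV. f (i, j))"
    by (simp add: sum.cartesian_product)
  then show ?thesis by (simp add: sum_2)
qed

lemma beta_hat_tensor: "beta_hat (tensor u v) = adj2 u ** v"
  by (simp add: beta_hat_def sum_22 tensor_def vec_eq_iff forall_2 unit_mat_def adj2_def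
      matrix_matrix_mult_def sum_2)

lemma beta_hat_add: "beta_hat (A + B) = beta_hat A + beta_hat B"
  by (simp add: beta_hat_def sum.distrib mats.scale_left_distrib)

lemma beta_hat_scale: "beta_hat (c *m A) = c *m beta_hat A"
  by (simp add: beta_hat_def mats.scale_sum_right)

lemma beta_hat_diff: "beta_hat (A - B) = beta_hat A - beta_hat B"
  using beta_hat_add[of "A - B" B] by simp

lemma beta_hat_wedge: "beta_hat (wedge u v) = beta u v"
  by (simp add: wedge_def beta_def beta_hat_diff beta_hat_tensor)

lemma tensor_add_left: "tensor (u + u') v = tensor u v + tensor u' v"
  and tensor_add_right: "tensor u (v + v') = tensor u v + tensor u v'"
  and tensor_scale_left: "tensor (c *m u) v = c *m tensor u v"
  and tensor_scale_right: "tensor u (c *m v) = c *m tensor u v"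
  by (simp_all add: tensor_def vec_eq_iff algebra_simps)

lemma tensor_sum_left: "tensor (sum f S) v = (\<Sum>i\<in>S. tensor (f i) v)"
  and tensor_sum_right: "tensor v (sum f S) = (\<Sum>i\<in>S. tensor v (f i))"
  by (simp_all add: tensor_def vec_eq_iff sum_distrib_left sum_distrib_right)

lemma unit_mat_expansion: "u = (\<Sum>p\<in>UNIV. u $ fst p $ snd p *m unit_mat p)"
  by (simp add: sum_22 vec_eq_iff forall_2 unit_mat_def)

lemma ext_map_add: "ext_map \<sigma> (A + B) = ext_map \<sigma> A + ext_map \<sigma> B"
  by (simp add: ext_map_def sum.distrib mats.scale_left_distrib)

lemma ext_map_scale: "ext_map \<sigma> (c *m A) = c *m ext_map \<sigma> A"
  by (simp add: ext_map_def mats.scale_sum_right)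

lemma ext_map_diff: "ext_map \<sigma> (A - B) = ext_map \<sigma> A - ext_map \<sigma> B"
  using ext_map_add[of \<sigma> "A - B" B] by simp

lemma ext_map_tensor:
  assumes "Vector_Spaces.linear (*m) (*m) \<sigma>"
  shows "ext_map \<sigma> (tensor u v) = tensor (\<sigma> u) (\<sigma> v)"
proof -
  interpret Vector_Spaces.linear "(*m)" "(*m)" \<sigma> by (fact assms)
  have e: "\<sigma> w = (\<Sum>p\<in>UNIV. w $ fst p $ snd p *m \<sigma> (unit_mat p))" for w
    by (subst unit_mat_expansion[of w]) (simp only: sum scale)
  have "tensor (\<sigma> u) (\<sigma> v) = (\<Sum>p\<in>UNIV. \<Sum>q\<in>UNIV.
      tensor (u $ fst p $ snd p *m \<sigma> (unit_mat p)) (v $ fst q $ snd q *m \<sigma> (unit_mat q)))"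
    by (subst e[of u], subst e[of v]) (simp only: tensor_sum_left, simp only: tensor_sum_right)
  then show ?thesis
    by (simp add: ext_map_def tensor_scale_left tensor_scale_right)
       (simp add: tensor_def mult.commute)
qed

lemma ext_map_wedge:
  "Vector_Spaces.linear (*m) (*m) \<sigma> \<Longrightarrow> ext_map \<sigma> (wedge u v) = wedge (\<sigma> u) (\<sigma> v)"
  by (simp add: wedge_def ext_map_diff ext_map_tensor)

lemma wedge_in_ext_square: "wedge u v \<in> ext_square"
  by (auto simp: ext_square_def intro: mats.span_base)

lemma ext_square_induct [consumes 1, case_names zero add]:
  assumes "A \<in> ext_square" "P 0" "\<And>c u v B. B \<in> ext_square \<Longrightarrow> P B \<Longrightarrow> P (c *m wedge u v + B)"
  shows "P A"
proof -
  have "A \<in> ext_square \<and> P A"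
    using assms(1) unfolding ext_square_def
  proof (induction rule: mats.span_induct_alt)
    case base
    show ?case by (simp add: assms(2) mats.span_zero)
  next
    case (step c x y)
    then obtain u v where x: "x = wedge u v" by auto
    show ?case
      using step assms(3)[of y c u v] mats.span_base[OF step(1)]
      unfolding ext_square_def x by (simp add: mats.span_add mats.span_scale)
  qed
  then show ?thesis ..
qed

lemma ext_map_zero: "ext_map \<sigma> 0 = 0" and beta_hat_zero: "beta_hat 0 = 0"
  using ext_map_scale[of \<sigma> 0 0] beta_hat_scale[of 0 0] by simp_all

lemma ext_map_in_ext_square:
  assumes "Vector_Spaces.linear (*m) (*m) \<sigma>" "A \<in> ext_square"
  shows "ext_map \<sigma> A \<in> ext_square"
  using assms(2)
proof (induction rule: ext_square_induct)
  case zero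
  show ?case by (simp add: ext_map_zero ext_square_def mats.span_zero)
next
  case (add c u v B)
  then show ?case
    using wedge_in_ext_square[of "\<sigma> u" "\<sigma> v"]
    by (simp add: ext_map_add ext_map_scale ext_map_wedge[OF assms(1)] ext_square_def
        mats.span_add mats.span_scale)
qed

lemma ext_map_comp:
  assumes "Vector_Spaces.linear (*m) (*m) \<sigma>" "Vector_Spaces.linear (*m) (*m) \<tau>"
    and "A \<in> ext_square"
  shows "ext_map (\<sigma> \<circ> \<tau>) A = ext_map \<sigma> (ext_map \<tau> A)"
  using assms(3)
proof (induction rule: ext_square_induct)
  case zero
  show ?case by (simp add: ext_map_zero)
next
  case (add c u v B)
  then show ?case
    using ext_map_wedge[OF Vector_Spaces.linear_compose[OF assms(2,1)], of u v, unfolded comp_def]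
    by (simp add: ext_map_add ext_map_scale ext_map_wedge assms(1,2) comp_def)
qed

lemma ext_map_id: "A \<in> ext_square \<Longrightarrow> ext_map id A = A"
proof (induction rule: ext_square_induct)
  case (add c u v B)
  then show ?case
    using ext_map_wedge[OF mats.linear_id, of u v, unfolded id_def]
    by (simp add: ext_map_add ext_map_scale id_def)
qed (simp add: ext_map_zero)

lemma trace_2: "trace (x :: 'k::field^2^2) = x$1$1 + x$2$2"
  by (simp add: trace_def sum_2)

lemma beta_in_pure: "beta u v \<in> pure"
  by (simp add: pure_def trace_2 beta_def adj2_def matrix_matrix_mult_def sum_2 algebra_simps)

lemma pure_zero: "0 \<in> pure"
  and pure_add: "x \<in> pure \<Longrightarrow> y \<in> pure \<Longrightarrow> x + y \<in> pure"
  and pure_scale: "x \<in> pure \<Longrightarrow> c *m x \<in> pure"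
  by (simp_all add: pure_def trace_def sum.distrib flip: sum_distrib_left)

lemma beta_one_half:
  assumes "(2::'k::field) \<noteq> 0" "x \<in> pure"
  shows "beta (mat 1) (inverse 2 *m x) = (x :: 'k^2^2)"
proof -
  have t: "x$2$2 = - (x$1$1)"
    using assms(2) by (simp add: pure_def trace_2 eq_neg_iff_add_eq_0 add.commute)
  have h: "inverse 2 * a + inverse 2 * a = a" for a :: 'k
    using assms(1) by (simp flip: mult_2 add: mult.assoc[symmetric])
  show ?thesis
    by (simp add: beta_def adj2_def vec_eq_iff forall_2 matrix_matrix_mult_def sum_2 mat_def t h assms(1))
qed

lemma Sigma_beta_linear: "\<sigma> \<in> Sigma_beta \<Longrightarrow> Vector_Spaces.linear (*m) (*m) \<sigma>"
  and Sigma_beta_bij: "\<sigma> \<in> Sigma_beta \<Longrightarrow> bij \<sigma>"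
  by (simp_all add: Sigma_beta_def)

lemma bij_linear_inv:
  assumes "Vector_Spaces.linear (*m) (*m) \<sigma>" "bij \<sigma>"
  shows "Vector_Spaces.linear (*m) (*m) (inv_into UNIV \<sigma>)"
proof -
  interpret Vector_Spaces.linear "(*m)" "(*m)" \<sigma> by (fact assms)
  have s: "\<sigma> (inv_into UNIV \<sigma> x) = x" for x using assms(2) by (simp add: bij_is_surj surj_f_inv_f)
  have i: "inv_into UNIV \<sigma> (\<sigma> x) = x" for x using assms(2) by (simp add: bij_is_inj)
  show ?thesis
  proof unfold_locales
    show "inv_into UNIV \<sigma> (x + y) = inv_into UNIV \<sigma> x + inv_into UNIV \<sigma> y" for x y
      using i[of "inv_into UNIV \<sigma> x + inv_into UNIV \<sigma> y"] by (simp add: add s)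
    show "inv_into UNIV \<sigma> (c *m x) = c *m inv_into UNIV \<sigma> x" for c x
      using i[of "c *m inv_into UNIV \<sigma> x"] by (simp add: scale s)
  qed
qed

lemma ext_map_inv:
  assumes "Vector_Spaces.linear (*m) (*m) \<sigma>" "bij \<sigma>" "A \<in> ext_square"
  shows "ext_map (inv_into UNIV \<sigma>) (ext_map \<sigma> A) = A" "ext_map \<sigma> (ext_map (inv_into UNIV \<sigma>) A) = A"
proof -
  have c: "inv_into UNIV \<sigma> \<circ> \<sigma> = id" "\<sigma> \<circ> inv_into UNIV \<sigma> = id"
    using assms(2) by (auto simp: bij_is_inj bij_is_surj surj_f_inv_f)
  note l = bij_linear_inv[OF assms(1,2)]
  show "ext_map (inv_into UNIV \<sigma>) (ext_map \<sigma> A) = A" "ext_map \<sigma> (ext_map (inv_into UNIV \<sigma>) A) = A"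
    using ext_map_comp[OF l assms(1,3)] ext_map_comp[OF assms(1) l assms(3)]
    by (simp_all add: c ext_map_id assms(3))
qed

lemma GL_pure_zero: "s \<in> GL_pure \<Longrightarrow> s 0 = 0"
  using pure_zero unfolding GL_pure_def by (force dest: spec[of _ 0])

lemma GL_pure_beta_hat:
  assumes "s \<in> GL_pure" "\<And>u v. s (beta u v) = beta (\<sigma> u) (\<sigma> v)"
    and "Vector_Spaces.linear (*m) (*m) \<sigma>" "A \<in> ext_square"
  shows "beta_hat A \<in> pure \<and> s (beta_hat A) = beta_hat (ext_map \<sigma> A)"
  using assms(4)
proof (induction rule: ext_square_induct)
  case zero
  show ?case by (simp add: beta_hat_zero ext_map_zero pure_zero GL_pure_zero[OF assms(1)])
next
  case (add c u v B)
  have "s (c *m beta u v + beta_hat B) = c *m s (beta u v) + s (beta_hat B)"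
    using assms(1) add beta_in_pure[of u v] pure_scale[OF beta_in_pure[of u v], of c]
    by (simp add: GL_pure_def)
  then show ?case
    using add pure_add[OF pure_scale[OF beta_in_pure[of u v], of c], of "beta_hat B"]
    by (simp add: beta_hat_add beta_hat_scale beta_hat_wedge ext_map_add ext_map_scale
        ext_map_wedge[OF assms(3)] assms(2))
qed

text \<open>The description of the group by induced maps on the space of pure elements.\<close>

theorem Sigma_beta_iff:
  fixes \<sigma> :: "'k::field^2^2 \<Rightarrow> 'k^2^2"
  assumes two: "(2::'k) \<noteq> 0"
  shows "\<sigma> \<in> Sigma_beta \<longleftrightarrow> Vector_Spaces.linear (*m) (*m) \<sigma> \<and> bij \<sigma> \<and>
           (\<exists>s \<in> GL_pure. \<forall>u v. s (beta u v) = beta (\<sigma> u) (\<sigma> v))"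
proof (cases "Vector_Spaces.linear (*m) (*m) \<sigma> \<and> bij \<sigma>")
  case True
  then have lin: "Vector_Spaces.linear (*m) (*m) \<sigma>" and bij: "bij \<sigma>" by auto
  note half = beta_one_half[OF two]
  have "(\<exists>s \<in> GL_pure. \<forall>u v. s (beta u v) = beta (\<sigma> u) (\<sigma> v))"
    if kinv: "ext_map \<sigma> ` ker_beta_hat = ker_beta_hat"
  proof -
    define w :: "'k^2^2 \<Rightarrow> 'k tensor2" where "w x = wedge (mat 1) (inverse 2 *m x)" for x
    define s where "s = (\<lambda>x \<in> pure. beta_hat (ext_map \<sigma> (w x)))"
    have w: "w x \<in> ext_square" for x by (simp add: w_def wedge_in_ext_square)
    have w_add: "w (x + y) = w x + w y" and w_scale: "w (c *m x) = c *m w x" for x y c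
      by (simp_all add: w_def wedge_def tensor_add_left tensor_add_right tensor_scale_left
          tensor_scale_right mats.scale_right_distrib mats.scale_right_diff_distrib
          mats.scale_left_commute[of _ c])
    have bw: "beta_hat (w x) = x" if "x \<in> pure" for x
      using half[OF that] by (simp add: w_def beta_hat_wedge)
    have key: "s (beta u v) = beta (\<sigma> u) (\<sigma> v)" for u v
    proof -
      have "w (beta u v) - wedge u v \<in> ext_square"
        using w wedge_in_ext_square unfolding ext_square_def by (rule mats.span_diff)
      then have "w (beta u v) - wedge u v \<in> ker_beta_hat"
        by (simp add: ker_beta_hat_def beta_hat_diff bw beta_in_pure beta_hat_wedge)
      then have "beta_hat (ext_map \<sigma> (w (beta u v) - wedge u v)) = 0"
        using kinv by (auto simp: ker_beta_hat_def)
      then show ?thesis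
        by (simp add: ext_map_diff beta_hat_diff ext_map_wedge[OF lin] beta_hat_wedge s_def
            beta_in_pure)
    qed
    have add: "s (x + y) = s x + s y" if "x \<in> pure" "y \<in> pure" for x y
      using that by (simp add: s_def w_add ext_map_add beta_hat_add pure_add)
    have scale: "s (c *m x) = c *m s x" if "x \<in> pure" for x c
      using that by (simp add: s_def w_scale ext_map_scale beta_hat_scale pure_scale)
    have ker: "x = 0" if x: "x \<in> pure" "s x = 0" for x
    proof -
      have "ext_map \<sigma> (w x) \<in> ker_beta_hat"
        using x by (simp add: ker_beta_hat_def s_def w ext_map_in_ext_square lin)
      then obtain A where A: "A \<in> ker_beta_hat" "ext_map \<sigma> (w x) = ext_map \<sigma> A"
        using kinv by blast
      then have "w x = A"
        using ext_map_inv(1)[OF lin bij, of A] ext_map_inv(1)[OF lin bij w, of x]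
        by (simp add: ker_beta_hat_def)
      then show ?thesis using A bw[OF x(1)] by (simp add: ker_beta_hat_def)
    qed
    have inj: "inj_on s pure"
    proof (rule inj_onI)
      fix x y assume xy: "x \<in> pure" "y \<in> pure" "s x = s y"
      then have "s (x + (-1) *m y) = 0"
        by (simp add: add scale pure_scale del: mats.scale_minus_left) simp
      with ker[of "x + (-1) *m y"] xy show "x = y"
        by (simp add: pure_add pure_scale del: mats.scale_minus_left) simp
    qed
    have "s ` pure = pure"
    proof
      show "s ` pure \<subseteq> pure"
        using beta_in_pure by (auto simp: s_def w_def ext_map_wedge[OF lin] beta_hat_wedge)
      show "pure \<subseteq> s ` pure"
      proof
        fix y :: "'k^2^2" assume "y \<in> pure"
        then have "y = beta (\<sigma> (inv_into UNIV \<sigma> (mat 1))) (\<sigma> (inv_into UNIV \<sigma> (inverse 2 *m y)))"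
          using half bij by (simp add: bij_is_surj surj_f_inv_f)
        then show "y \<in> s ` pure" unfolding key[symmetric] using beta_in_pure by blast
      qed
    qed
    then have "s \<in> GL_pure"
      using inj add scale by (simp add: GL_pure_def Bij_def bij_betw_def) (simp add: s_def)
    with key show ?thesis by blast
  qed
  moreover have "ext_map \<sigma> ` ker_beta_hat = ker_beta_hat"
    if s: "s \<in> GL_pure" "\<And>u v. s (beta u v) = beta (\<sigma> u) (\<sigma> v)" for s
  proof
    note sb = GL_pure_beta_hat[OF s lin]
    show "ext_map \<sigma> ` ker_beta_hat \<subseteq> ker_beta_hat"
      using sb ext_map_in_ext_square[OF lin] GL_pure_zero[OF s(1)]
      by (fastforce simp: ker_beta_hat_def)
    show "ker_beta_hat \<subseteq> ext_map \<sigma> ` ker_beta_hat"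
    proof
      fix B :: "'k tensor2" assume B: "B \<in> ker_beta_hat"
      define A where "A = ext_map (inv_into UNIV \<sigma>) B"
      have A: "A \<in> ext_square" "ext_map \<sigma> A = B"
        using B by (simp_all add: A_def ker_beta_hat_def ext_map_in_ext_square
            bij_linear_inv lin bij ext_map_inv)
      have "s (beta_hat A) = s 0"
        using sb[OF A(1)] A B GL_pure_zero[OF s(1)] by (simp add: ker_beta_hat_def)
      then have "beta_hat A = 0"
        using s(1) sb[OF A(1)] pure_zero
        by (auto simp: GL_pure_def Bij_def bij_betw_def dest: inj_onD)
      then show "B \<in> ext_map \<sigma> ` ker_beta_hat" using A by (force simp: ker_beta_hat_def)
    qed
  qed
  ultimately have "ext_map \<sigma> ` ker_beta_hat = ker_beta_hat \<longleftrightarrow>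
      (\<exists>s \<in> GL_pure. \<forall>u v. s (beta u v) = beta (\<sigma> u) (\<sigma> v))"
    by blast
  then show ?thesis using True by (simp add: Sigma_beta_def)
qed (auto simp: Sigma_beta_def)

lemma GL_pure_eqI:
  fixes s t :: "'k::field^2^2 \<Rightarrow> 'k^2^2"
  assumes "(2::'k) \<noteq> 0" "s \<in> GL_pure" "t \<in> GL_pure" "\<And>u v. s (beta u v) = t (beta u v)"
  shows "s = t"
proof (rule extensionalityI)
  show "s \<in> extensional pure" "t \<in> extensional pure"
    using assms by (auto simp: GL_pure_def Bij_def)
  show "s x = t x" if "x \<in> pure" for x
    using assms(4)[of "mat 1" "inverse 2 *m x"] beta_one_half[OF assms(1) that] by simp
qed

lemma induced_eqI:
  fixes \<sigma> :: "'k::field^2^2 \<Rightarrow> 'k^2^2"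
  assumes "(2::'k) \<noteq> 0" "s \<in> GL_pure" "\<And>u v. s (beta u v) = beta (\<sigma> u) (\<sigma> v)"
  shows "induced \<sigma> = s"
  unfolding induced_def
  by (rule the_equality) (use assms in \<open>auto intro: GL_pure_eqI\<close>)

lemma induced:
  fixes \<sigma> :: "'k::field^2^2 \<Rightarrow> 'k^2^2"
  assumes "(2::'k) \<noteq> 0" "\<sigma> \<in> Sigma_beta"
  shows "induced \<sigma> \<in> GL_pure" "induced \<sigma> (beta u v) = beta (\<sigma> u) (\<sigma> v)"
proof -
  obtain s where s: "s \<in> GL_pure" "\<And>u v. s (beta u v) = beta (\<sigma> u) (\<sigma> v)"
    using assms(2) unfolding Sigma_beta_iff[OF assms(1)] by blast
  then have "induced \<sigma> = s" by (rule induced_eqI[OF assms(1)])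
  with s show "induced \<sigma> \<in> GL_pure" "induced \<sigma> (beta u v) = beta (\<sigma> u) (\<sigma> v)" by simp_all
qed

lemma Sigma_beta_comp:
  assumes "\<sigma> \<in> Sigma_beta" "\<tau> \<in> Sigma_beta"
  shows "\<sigma> \<circ> \<tau> \<in> Sigma_beta"
proof -
  note l = Sigma_beta_linear[OF assms(1)] Sigma_beta_linear[OF assms(2)]
  have "ext_map (\<sigma> \<circ> \<tau>) ` ker_beta_hat = ext_map \<sigma> ` ext_map \<tau> ` ker_beta_hat"
    unfolding image_image
    by (intro image_cong refl ext_map_comp l) (auto simp: ker_beta_hat_def)
  then show ?thesis
    using assms Vector_Spaces.linear_compose[OF l(2,1)] by (simp add: Sigma_beta_def bij_comp)
qed

lemma Sigma_beta_id: "id \<in> Sigma_beta"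
  by (force simp: Sigma_beta_def mats.linear_id ker_beta_hat_def ext_map_id)

lemma Sigma_beta_inv:
  assumes "\<sigma> \<in> Sigma_beta"
  shows "inv_into UNIV \<sigma> \<in> Sigma_beta"
proof -
  note l = Sigma_beta_linear[OF assms] and b = Sigma_beta_bij[OF assms]
  have "ext_map (inv_into UNIV \<sigma>) ` ext_map \<sigma> ` ker_beta_hat = ker_beta_hat"
    unfolding image_image
    by (simp add: ker_beta_hat_def ext_map_inv l b cong: image_cong_simp)
  moreover have "ext_map \<sigma> ` ker_beta_hat = ker_beta_hat"
    using assms by (simp add: Sigma_beta_def)
  ultimately show ?thesis
    using l b by (simp add: Sigma_beta_def bij_linear_inv bij_imp_bij_inv)
qed

theorem group_Sigma_grp: "group Sigma_grp"
proof (rule groupI)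
  fix \<sigma> :: "'a^2^2 \<Rightarrow> 'a^2^2" assume "\<sigma> \<in> carrier Sigma_grp"
  then have "inv_into UNIV \<sigma> \<in> carrier Sigma_grp" "inv_into UNIV \<sigma> \<circ> \<sigma> = id"
    by (auto simp: Sigma_grp_def Sigma_beta_inv Sigma_beta_bij bij_is_inj)
  then show "\<exists>\<tau> \<in> carrier Sigma_grp. \<tau> \<otimes>\<^bsub>Sigma_grp\<^esub> \<sigma> = \<one>\<^bsub>Sigma_grp\<^esub>"
    by (auto simp: Sigma_grp_def)
qed (auto simp: Sigma_grp_def Sigma_beta_comp Sigma_beta_id o_assoc)

theorem Sigma_grp_action: "group_action Sigma_grp UNIV (\<lambda>\<sigma>. \<sigma>)"
proof -
  have "(\<lambda>\<sigma>. \<sigma>) \<in> hom Sigma_grp (BijGroup UNIV)"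
    by (auto simp: hom_def BijGroup_def Bij_def Sigma_grp_def Sigma_beta_def compose_def comp_def)
  then show ?thesis
    by (simp add: group_action_def group_hom_def group_hom_axioms_def group_Sigma_grp
        group_BijGroup)
qed

theorem Sigma_grp_action_pure:
  assumes two: "(2::'k::field) \<noteq> 0"
  shows "group_action Sigma_grp (pure :: ('k^2^2) set) induced"
proof -
  have B: "induced \<sigma> \<in> Bij pure" if "\<sigma> \<in> Sigma_beta" for \<sigma> :: "'k^2^2 \<Rightarrow> 'k^2^2"
    using induced(1)[OF two that] by (simp add: GL_pure_def)
  have "induced (\<sigma> \<circ> \<tau>) = compose pure (induced \<sigma>) (induced \<tau>)"
    if st: "\<sigma> \<in> Sigma_beta" "\<tau> \<in> Sigma_beta" for \<sigma> \<tau> :: "'k^2^2 \<Rightarrow> 'k^2^2"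
  proof (rule induced_eqI[OF two])
    show "compose pure (induced \<sigma>) (induced \<tau>) \<in> GL_pure"
      using induced(1)[OF two st(1)] induced(1)[OF two st(2)] Bij_imp_funcset[of "induced \<tau>" pure]
      by (auto simp: GL_pure_def compose_Bij compose_eq pure_add pure_scale Pi_iff)
    show "compose pure (induced \<sigma>) (induced \<tau>) (beta u v) = beta ((\<sigma> \<circ> \<tau>) u) ((\<sigma> \<circ> \<tau>) v)" for u v
      by (simp add: compose_eq beta_in_pure induced(2)[OF two] st)
  qed
  then have "induced \<in> hom Sigma_grp (BijGroup (pure :: ('k^2^2) set))"
    using B by (auto simp: hom_def BijGroup_def Sigma_grp_def)
  then show ?thesis
    by (simp add: group_action_def group_hom_def group_hom_axioms_def group_Sigma_grp
        group_BijGroup)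
qed

end

theory Submission
  imports Defs
begin

text \<open>All maps \<open>x \<mapsto> a x b\<close> with \<open>a\<close>, \<open>b\<close> invertible lie in \<open>\<Sigma>\<^sub>\<beta>\<close> and induce
  \<open>x \<mapsto> det a \<cdot> b\<^sup>~ x b\<close> on the pure elements \<open>P\<close>, where \<open>b\<^sup>~\<close> is the adjugate; this makes the orbits
  at least as large as claimed. Conversely, \<open>det u \<noteq> 0\<close> holds iff \<open>\<beta>(u, \<cdot>)\<close> maps onto \<open>P\<close>, so
  \<open>\<Sigma>\<^sub>\<beta>\<close> preserves singularity and hence the rank. For the action on \<open>P\<close>, a left multiplication
  reduces to \<open>\<tau>\<close> with \<open>\<tau>(1) = 1\<close>. As \<open>x \<plusminus> 1\<close> is singular for every \<open>x \<in> P\<close> with \<open>det x = -1\<close>,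
  and such \<open>x\<close> span \<open>P\<close>, the map \<open>\<tau>\<close> leaves \<open>P\<close> invariant; it then coincides there with the
  induced map and preserves \<open>\<beta>\<close>. The identity \<open>\<beta>(x, \<beta>(x, \<beta>(x, y))) = -4 det x \<cdot> \<beta>(x, y)\<close> on \<open>P\<close> now
  shows that \<open>\<tau>\<close> preserves the determinant, which separates the conjugacy classes of nonzero
  pure elements.\<close>

section \<open>Characteristic and rank\<close>

lemma CHAR_neq_2_imp_two_neq_0:
  assumes "CHAR('k::field) \<noteq> 2"
  shows "(2::'k) \<noteq> 0"
proof
  assume "(2::'k) = 0"
  then have "CHAR('k) dvd 2"
    using of_nat_eq_0_iff_char_dvd[where 'a='k, of 2] by simp
  then have "CHAR('k) \<le> 2" "CHAR('k) \<noteq> 0" by (auto dest: dvd_imp_le intro: gr0I)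
  moreover have "CHAR('k) \<noteq> Suc 0" by simp
  ultimately show False using assms by linarith
qed

lemma rank_eq_0_iff: "rank (A :: 'k::field^'n^'m) = 0 \<longleftrightarrow> A = 0"
proof -
  have "rank A = 0 \<longleftrightarrow> (\<forall>i. row i A = 0)"
    by (auto simp: row_rank_def_gen rows_def)
  then show ?thesis by (simp add: row_def vec_eq_iff)
qed

lemma rank_full_iff_det: "rank (A :: 'k::field^'n^'n) = CARD('n) \<longleftrightarrow> det A \<noteq> 0"
  unfolding row_rank_def_gen invertible_det_nz[symmetric] invertible_left_inverse
    matrix_left_invertible_span_rows_gen vec.dim_eq_full[symmetric]
  by (simp add: vec.dimension_def card_cart_basis)

lemma rank_le_CARD: "rank (A :: 'k::field^'n^'m) \<le> CARD('n)"
  unfolding row_rank_def_gen by (rule dim_subset_UNIV_cart_gen)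

section \<open>Entrywise calculus and the adjugate\<close>

lemma mult2_nth: "(x ** y) $ i $ j = x $ i $ 1 * y $ 1 $ j + x $ i $ 2 * y $ 2 $ j"
  for x y :: "'k::field^2^2"
  by (simp add: matrix_matrix_mult_def sum_2)

lemma mat1_nth: "(mat 1 :: 'k::field^2^2) $ i $ j = (if i = j then 1 else 0)"
  by (simp add: mat_def)

text \<open>Reduces identities between 2-by-2 matrices to polynomial identities in the
  entries.\<close>

lemmas mat2_entry = vec_eq_iff forall_2 mult2_nth mat1_nth adj2_def beta_def det_2

lemma pure_22: "x \<in> pure \<longleftrightarrow> x $ 2 $ 2 = - (x $ 1 $ 1)"
  by (simp add: pure_def trace_2 eq_neg_iff_add_eq_0 add.commute)

lemma adj2_mult_self: "adj2 x ** x = det x *m mat 1"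
  and mult_adj2_self: "x ** adj2 x = det x *m mat 1"
  by (simp_all add: mat2_entry algebra_simps)

lemma adj2_mult: "adj2 (x ** y) = adj2 y ** adj2 x"
  by (simp add: mat2_entry algebra_simps)

lemma adj2_adj2 [simp]: "adj2 (adj2 x) = x"
  by (simp add: mat2_entry)

lemma det_adj2 [simp]: "det (adj2 x) = det x"
  by (simp add: mat2_entry algebra_simps)

lemma det_scale2: "det (c *m x) = c\<^sup>2 * det x" for x :: "'k::field^2^2"
  by (simp add: mat2_entry power2_eq_square algebra_simps)

lemma mat_scale_mult: "(c *m x) ** y = c *m (x ** y)" "x ** (c *m y) = c *m (x ** y)"
  for x y :: "'k::field^2^2"
  by (simp_all add: mat2_entry algebra_simps)

text \<open>\<open>adj2\<close> reverses products, so \<open>adj2 a ** a\<close> meets in the middle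
  and collapses to the scalar \<open>det a\<close>.\<close>

lemma beta_mult: "beta (a ** x ** b) (a ** y ** b) = det a *m (adj2 b ** beta x y ** b)"
proof -
  have "adj2 (a ** x ** b) ** (a ** y ** b) = det a *m (adj2 b ** (adj2 x ** y) ** b)" for x y
  proof -
    have "adj2 (a ** x ** b) ** (a ** y ** b) = adj2 b ** adj2 x ** (adj2 a ** a) ** y ** b"
      by (simp add: adj2_mult matrix_mul_assoc)
    then show ?thesis by (simp add: adj2_mult_self mat_scale_mult matrix_mul_assoc)
  qed
  then show ?thesis
    by (simp add: beta_def mats.scale_right_diff_distrib) (simp add: mat2_entry algebra_simps)
qed

lemma adj2_conj_adj2: "b ** (adj2 b ** x ** b) ** adj2 b = (det b)\<^sup>2 *m x"
proof -
  have "b ** (adj2 b ** x ** b) ** adj2 b = (b ** adj2 b) ** x ** (b ** adj2 b)"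
    by (simp add: matrix_mul_assoc)
  then show ?thesis
    by (simp add: mult_adj2_self mat_scale_mult power2_eq_square)
qed

section \<open>Two-sided multiplications as members of \<open>Sigma_beta\<close>\<close>

lemma two_sided_linear: "Vector_Spaces.linear (*m) (*m) (\<lambda>x. a ** x ** b)" for a b :: "'k::field^2^2"
  by unfold_locales (simp_all add: mat2_entry algebra_simps)

lemma two_sided_bij:
  fixes a b :: "'k::field^2^2"
  assumes "det a \<noteq> 0" "det b \<noteq> 0"
  shows "bij (\<lambda>x. a ** x ** b)"
proof -
  obtain a' b' where *: "a ** a' = mat 1" "a' ** a = mat 1" "b ** b' = mat 1" "b' ** b = mat 1"
    using assms unfolding invertible_det_nz[symmetric] invertible_def by blast
  have "a ** (a' ** x ** b') ** b = a ** a' ** x ** (b' ** b)"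
       "a' ** (a ** x ** b) ** b' = a' ** a ** x ** (b ** b')" for x
    by (simp_all add: matrix_mul_assoc)
  then show ?thesis
    by (intro o_bij[of "\<lambda>x. a' ** x ** b'"]) (simp_all add: * fun_eq_iff)
qed

lemma pure_adj2_conj: "x \<in> pure \<Longrightarrow> adj2 b ** x ** b \<in> pure"
  by (simp add: pure_22 mat2_entry algebra_simps)

lemma two_sided_GL_pure:
  fixes a b :: "'k::field^2^2"
  assumes "det a \<noteq> 0" "det b \<noteq> 0"
  shows "(\<lambda>x\<in>pure. det a *m (adj2 b ** x ** b)) \<in> GL_pure"
proof -
  \<comment> \<open>The scalar in the inverse cancels \<open>det a\<close> and the factor
    \<open>(det b)\<^sup>2\<close> from \<open>adj2_conj_adj2\<close>.\<close>
  have "bij_betw (\<lambda>x. det a *m (adj2 b ** x ** b)) pure pure"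
  proof (rule bij_betw_byWitness[where f' = "\<lambda>y. inverse (det a * (det b)\<^sup>2) *m (b ** y ** adj2 b)"])
    show "\<forall>x\<in>pure. inverse (det a * (det b)\<^sup>2) *m (b ** (det a *m (adj2 b ** x ** b)) ** adj2 b) = x"
      using assms by (simp add: mat_scale_mult adj2_conj_adj2 field_simps)
    show "\<forall>y\<in>pure. det a *m (adj2 b ** (inverse (det a * (det b)\<^sup>2) *m (b ** y ** adj2 b)) ** b) = y"
      using assms adj2_conj_adj2[of "adj2 b"] by (simp add: mat_scale_mult field_simps)
  qed (use pure_adj2_conj[of _ "adj2 b"] in \<open>auto intro!: pure_scale pure_adj2_conj\<close>)
  moreover have "det a *m (adj2 b ** (x + y) ** b)
      = det a *m (adj2 b ** x ** b) + det a *m (adj2 b ** y ** b)" for x y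
    by (simp add: mat2_entry algebra_simps)
  ultimately show ?thesis
    by (simp add: GL_pure_def Bij_def pure_add pure_scale mat_scale_mult mats.scale_left_commute)
qed

lemma two_sided_Sigma_beta:
  fixes a b :: "'k::field^2^2"
  assumes two: "(2::'k) \<noteq> 0" and "det a \<noteq> 0" "det b \<noteq> 0"
  shows "(\<lambda>x. a ** x ** b) \<in> Sigma_beta"
    and "induced (\<lambda>x. a ** x ** b) = (\<lambda>x\<in>pure. det a *m (adj2 b ** x ** b))"
proof -
  note s = two_sided_GL_pure[OF assms(2,3)]
  have e: "(\<lambda>x\<in>pure. det a *m (adj2 b ** x ** b)) (beta u v) = beta (a ** u ** b) (a ** v ** b)" for u v
    by (simp add: beta_mult beta_in_pure)
  show "(\<lambda>x. a ** x ** b) \<in> Sigma_beta"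
    unfolding Sigma_beta_iff[OF two] using two_sided_linear two_sided_bij assms s e by blast
  show "induced (\<lambda>x. a ** x ** b) = (\<lambda>x\<in>pure. det a *m (adj2 b ** x ** b))"
    by (rule induced_eqI[OF two s e])
qed

section \<open>Conjugacy classes of trace-zero matrices\<close>

lemma matrix_inv_adj2:
  fixes g :: "'k::field^2^2"
  assumes "det g \<noteq> 0"
  shows "matrix_inv g = inverse (det g) *m adj2 g"
proof -
  have "g ** matrix_inv g = mat 1"
    using assms someI_ex[of "\<lambda>h. g ** h = mat 1 \<and> h ** g = mat 1"]
    unfolding invertible_det_nz[symmetric] invertible_def matrix_inv_def by blast
  then have "inverse (det g) *m (adj2 g ** g) ** matrix_inv g = inverse (det g) *m adj2 g"
    by (simp add: mat_scale_mult flip: matrix_mul_assoc)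
  then show ?thesis using assms by (simp add: adj2_mult_self mat_scale_mult)
qed

text \<open>In this form conjugation by \<open>g\<close> is, up to a scalar, the map induced by
  right multiplication with \<open>adj2 g\<close>.\<close>

lemma conj_class_adj2:
  "conj_class x = {inverse (det g) *m (g ** x ** adj2 g) | g. det g \<noteq> 0}"
  unfolding conj_class_def invertible_det_nz
  by (intro Collect_cong ex_cong1) (auto simp: matrix_inv_adj2 mat_scale_mult)

lemma scaled_conj_subset_orbit:
  fixes x :: "'k::field^2^2"
  assumes two: "(2::'k) \<noteq> 0" and "x \<in> pure"
  shows "(\<Union>c \<in> - {0}. (*m) c ` conj_class x) \<subseteq> orbit Sigma_grp induced x"
proof
  fix z assume "z \<in> (\<Union>c \<in> - {0}. (*m) c ` conj_class x)"
  then obtain c y where c: "c \<noteq> 0" and y: "y \<in> conj_class x" "z = c *m y" by auto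
  then obtain g where g: "det g \<noteq> 0" "y = inverse (det g) *m (g ** x ** adj2 g)"
    by (auto simp: conj_class_adj2)
  \<comment> \<open>The induced map sees \<open>a\<close> only through \<open>det a\<close>; this
    value absorbs the normalisation of \<open>y\<close> and supplies \<open>c\<close>.\<close>
  define a :: "'k^2^2" where "a = mat2 (c * inverse (det g)) 0 0 1"
  have a: "det a = c * inverse (det g)" by (simp add: a_def det_2)
  note s = two_sided_Sigma_beta[OF two, of a "adj2 g"]
  have "induced (\<lambda>x. a ** x ** adj2 g) x = c *m y"
    using a c g assms(2) by (simp add: s(2))
  with s(1) a c g y(2) show "z \<in> orbit Sigma_grp induced x"
    unfolding orbit_def Sigma_grp_def by force
qed

text \<open>The columns of \<open>g\<close> are \<open>v\<close> and \<open>x v\<close> for a cyclic vector \<open>v\<close> among \<open>e\<^sub>1\<close>, \<open>e\<^sub>2\<close>, \<open>e\<^sub>1 + e\<^sub>2\<close>.\<close>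

lemma conj_companion:
  fixes x :: "'k::field^2^2"
  assumes two: "(2::'k) \<noteq> 0" and x: "x \<in> pure" "x \<noteq> 0"
  obtains g where "det g \<noteq> 0" "x ** g = g ** mat2 0 (- det x) 1 0"
proof -
  define p q r where "p = x$1$1" and "q = x$1$2" and "r = x$2$1"
  have x22: "x$2$2 = - p" using x by (simp add: pure_22 p_def)
  \<comment> \<open>Cayley-Hamilton with trace 0 gives x(xv) = -det(x)v, so any v independent of xv
    is suitable.\<close>
  consider "r \<noteq> 0" | "q \<noteq> 0" | "q = 0" "r = 0" "p \<noteq> 0"
    using x x22 by (auto simp: vec_eq_iff forall_2 p_def q_def r_def)
  then show ?thesis
  proof cases
    case 1
    then show ?thesis
      by (intro that[of "mat2 1 p 0 r"]) (simp_all add: mat2_entry x22 flip: p_def q_def r_def)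
  next
    case 2
    then show ?thesis
      by (intro that[of "mat2 0 q 1 (- p)"]) (simp_all add: mat2_entry x22 flip: p_def q_def r_def)
  next
    case 3
    \<comment> \<open>This is the determinant of the third \<open>g\<close>, nonzero because the
      eigenvalues p and -p differ.\<close>
    have "- p - p = - (2 * p)" by simp
    then have "- p - p \<noteq> 0" using 3 two by simp
    then show ?thesis using 3
      by (intro that[of "mat2 1 p 1 (- p)"]) (simp_all add: mat2_entry x22 flip: p_def q_def r_def)
  qed
qed

text \<open>Both matrices are similar to the same companion matrix, which depends only on the
  determinant.\<close>

lemma conj_class_eq_det:
  fixes x :: "'k::field^2^2"
  assumes two: "(2::'k) \<noteq> 0" and x: "x \<in> pure" "x \<noteq> 0" and y: "y \<in> pure" "y \<noteq> 0"
    and d: "det y = det x"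
  shows "y \<in> conj_class x"
proof -
  obtain g where g: "det g \<noteq> 0" "x ** g = g ** mat2 0 (- det x) 1 0"
    using conj_companion[OF two x] .
  obtain h where h: "det h \<noteq> 0" "y ** h = h ** mat2 0 (- det x) 1 0"
    using conj_companion[OF two y] d by metis
  obtain g' where g': "g ** g' = mat 1" "g' ** g = mat 1"
    using g unfolding invertible_det_nz[symmetric] invertible_def by blast
  obtain h' where h': "h ** h' = mat 1" "h' ** h = mat 1"
    using h unfolding invertible_det_nz[symmetric] invertible_def by blast
  have "y ** (h ** g') = (h ** g') ** x"
  proof -
    have "y ** h ** g' = h ** (g' ** g) ** mat2 0 (- det x) 1 0 ** g'"
      using h by (simp add: g')
    also have "\<dots> = h ** g' ** (g ** mat2 0 (- det x) 1 0) ** g'" by (simp add: matrix_mul_assoc)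
    also have "\<dots> = h ** g' ** x ** (g ** g')" by (simp add: g(2)[symmetric] matrix_mul_assoc)
    finally show ?thesis by (simp add: g' matrix_mul_assoc)
  qed
  moreover have k: "det (h ** g') \<noteq> 0"
    using h arg_cong[OF g'(1), of det] by (auto simp: det_mul)
  have "(h ** g') ** matrix_inv (h ** g') = mat 1"
    using k by (simp add: matrix_inv_adj2 mult_adj2_self mat_scale_mult)
  ultimately have "y = (h ** g') ** x ** matrix_inv (h ** g')"
    by (metis matrix_mul_assoc matrix_mul_rid)
  then show ?thesis using k unfolding conj_class_def invertible_det_nz by blast
qed


section \<open>Rank as a complete orbit invariant on matrices\<close>

text \<open>Expresses singularity of \<open>u\<close> through \<open>beta\<close> alone, which is
  what \<open>Sigma_beta\<close> can transport.\<close>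

lemma beta_onto_pure_iff:
  fixes u :: "'k::field^2^2"
  assumes two: "(2::'k) \<noteq> 0"
  shows "pure \<subseteq> range (beta u) \<longleftrightarrow> det u \<noteq> 0"
proof (cases "det u = 0")
  case True
  \<comment> \<open>\<open>w \<mapsto> u ** w ** adj2 u\<close> vanishes on the image of \<open>beta u\<close>, but not on all of \<open>pure\<close>.\<close>
  have "\<exists>w \<in> pure. u ** w ** adj2 u \<noteq> 0 \<or> u = 0 \<and> w \<noteq> 0"
  \<comment> \<open>For an off-diagonal matrix unit \<open>w\<close> the product contains, up to
    sign, the squares of one column of \<open>u\<close>.\<close>
  proof (cases "u$1$1 = 0 \<and> u$2$1 = 0")
    case True
    then show ?thesis
      by (intro bexI[of _ "mat2 0 0 1 0"]) (auto simp: pure_22 mat2_entry)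
  next
    case False
    then show ?thesis
      by (intro bexI[of _ "mat2 0 1 0 0"]) (auto simp: pure_22 mat2_entry)
  qed
  moreover have "u ** beta u v ** adj2 u = 0" for v
  proof -
    have "u ** beta u v ** adj2 u = (u ** adj2 u) ** v ** adj2 u - u ** adj2 v ** (u ** adj2 u)"
      by (simp add: beta_def) (simp add: mat2_entry algebra_simps)
    then show ?thesis using True by (simp add: mult_adj2_self)
  qed
  \<comment> \<open>For \<open>u = 0\<close> the annihilating map is zero as well, so the range of
    \<open>beta 0\<close> is treated directly.\<close>
  moreover have "beta 0 v = 0" for v :: "'k^2^2" by (simp add: mat2_entry)
  ultimately show ?thesis using True by blast
next
  case False
  \<comment> \<open>As \<open>adj2 w = - w\<close> for pure \<open>w\<close>,
    \<open>beta u (u ** w)\<close> is \<open>2 * det u\<close> times \<open>w\<close>; dividing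
    gives the preimage.\<close>
  have "beta u (inverse (2 * det u) *m (u ** w)) = w" if "w \<in> pure" for w
  proof -
    have "beta u (c *m (u ** w)) = (2 * (c * det u)) *m w" for c
      using that unfolding pure_22 by (simp add: mat2_entry algebra_simps)
    then show ?thesis using False two by (simp add: field_simps)
  qed
  then show ?thesis using False by (metis rangeI subsetI)
qed

text \<open>Bijectivity of the induced map carries surjectivity of \<open>beta u\<close> onto
  \<open>pure\<close> over to \<open>beta (\<sigma> u)\<close>; the inverse of
  \<open>\<sigma>\<close> gives the converse.\<close>

lemma Sigma_beta_det_eq_0_iff:
  fixes u :: "'k::field^2^2"
  assumes two: "(2::'k) \<noteq> 0" and "\<sigma> \<in> Sigma_beta"
  shows "det (\<sigma> u) = 0 \<longleftrightarrow> det u = 0"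
proof -
  have *: "det (\<sigma> u) \<noteq> 0" if \<sigma>: "\<sigma> \<in> Sigma_beta" and u: "det u \<noteq> 0" for \<sigma> and u :: "'k^2^2"
  proof -
    have "w \<in> range (beta (\<sigma> u))" if "w \<in> pure" for w
    proof -
      have "bij_betw (induced \<sigma>) pure pure"
        using induced(1)[OF two \<sigma>] by (simp add: GL_pure_def Bij_def)
      then obtain w' where w': "w' \<in> pure" "w = induced \<sigma> w'"
        using \<open>w \<in> pure\<close> by (metis bij_betw_imp_surj_on imageE)
      obtain v where "w' = beta u v" using w' u beta_onto_pure_iff[OF two] by blast
      then show ?thesis using w' induced(2)[OF two \<sigma>] by auto
    qed
    then show ?thesis using beta_onto_pure_iff[OF two] by blast
  qed
  have "inv_into UNIV \<sigma> (\<sigma> u) = u"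
    using Sigma_beta_bij[OF assms(2)] by (simp add: bij_is_inj)
  then show ?thesis
    using *[OF assms(2)] *[OF Sigma_beta_inv[OF assms(2)], of "\<sigma> u"] by auto
qed

text \<open>The product is the first column of \<open>a\<close> times the first row of
  \<open>b\<close>; a nonzero entry of \<open>x\<close> determines a choice of both, which is
  completed to invertible matrices.\<close>

lemma rank_one_factorization:
  fixes x :: "'k::field^2^2"
  assumes "det x = 0" "x \<noteq> 0"
  obtains a b where "det a \<noteq> 0" "det b \<noteq> 0" "a ** mat2 1 0 0 0 ** b = x"
proof -
  define p q r s where "p = x$1$1" and "q = x$1$2" and "r = x$2$1" and "s = x$2$2"
  have d: "p * s = q * r" using assms by (simp add: det_2 p_def q_def r_def s_def)
  note defs = p_def[symmetric] q_def[symmetric] r_def[symmetric] s_def[symmetric]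
  consider "p \<noteq> 0" | "q \<noteq> 0" | "r \<noteq> 0" | "s \<noteq> 0"
    using assms(2) by (auto simp: vec_eq_iff forall_2 p_def q_def r_def s_def)
  then show ?thesis
  proof cases
    case 1
    then show ?thesis using d
      by (intro that[of "mat2 1 0 (r / p) 1" "mat2 p q 0 1"]) (simp_all add: mat2_entry defs field_simps)
  next
    case 2
    then show ?thesis using d
      by (intro that[of "mat2 1 0 (s / q) 1" "mat2 p q 1 0"]) (simp_all add: mat2_entry defs field_simps)
  next
    case 3
    then show ?thesis using d
      by (intro that[of "mat2 (p / r) 1 1 0" "mat2 r s 0 1"]) (simp_all add: mat2_entry defs field_simps)
  next
    case 4
    then show ?thesis using d
      by (intro that[of "mat2 (q / s) 1 1 0" "mat2 r s 1 0"]) (simp_all add: mat2_entry defs field_simps)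
  qed
qed

text \<open>Ranks 0 and 2 are detected by the vanishing of the matrix and of its determinant, and
  only 1 is left. Both tests are preserved by \<open>Sigma_beta\<close>.\<close>

lemma rank_mat2_eq_iff:
  fixes x y :: "'k::field^2^2"
  shows "rank x = rank y \<longleftrightarrow> (x = 0 \<longleftrightarrow> y = 0) \<and> (det x = 0 \<longleftrightarrow> det y = 0)"
  using rank_eq_0_iff[of x] rank_eq_0_iff[of y] rank_full_iff_det[of x] rank_full_iff_det[of y]
    rank_le_CARD[of x] rank_le_CARD[of y] by (auto simp: le_Suc_eq numeral_2_eq_2)

lemma Sigma_beta_eq_0_iff: "\<sigma> \<in> Sigma_beta \<Longrightarrow> \<sigma> x = 0 \<longleftrightarrow> x = 0"
proof -
  assume s: "\<sigma> \<in> Sigma_beta"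
  interpret Vector_Spaces.linear "(*m)" "(*m)" \<sigma> by (rule Sigma_beta_linear[OF s])
  show ?thesis using Sigma_beta_bij[OF s] zero by (metis bij_pointE)
qed

lemma ex_rank_rep:
  fixes x :: "'k::field^2^2"
  assumes two: "(2::'k) \<noteq> 0"
  shows "\<exists>t \<in> {mat2 0 0 0 0, mat2 1 0 0 0, mat2 1 0 0 1}. rank x = rank t \<and> x \<in> orbit Sigma_grp (\<lambda>\<sigma>. \<sigma>) t"
proof -
  have o: "a ** t ** b \<in> orbit Sigma_grp (\<lambda>\<sigma>. \<sigma>) t" if "det a \<noteq> 0" "det b \<noteq> 0" for a b t :: "'k^2^2"
    using two_sided_Sigma_beta(1)[OF two that] by (force simp: orbit_def Sigma_grp_def)
  have z: "mat2 0 0 0 0 = (0 :: 'k^2^2)" by (simp add: mat2_entry)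
  have n: "mat2 1 0 0 0 \<noteq> (0 :: 'k^2^2)" "mat2 1 0 0 1 \<noteq> (0 :: 'k^2^2)" by (simp_all add: mat2_entry)
  have i: "mat2 1 0 0 1 = (mat 1 :: 'k^2^2)" by (simp add: mat2_entry)
  have d: "det (mat2 1 0 0 0 :: 'k^2^2) = 0" by (simp add: det_2)
  consider "x = 0" | "x \<noteq> 0" "det x = 0" | "det x \<noteq> 0" by blast
  then show ?thesis
  proof cases
    case 1
    then have "x \<in> orbit Sigma_grp (\<lambda>\<sigma>. \<sigma>) (mat2 0 0 0 0)"
      using o[of "mat 1" "mat 1" 0] by (simp add: z det_I)
    then show ?thesis using 1 by (simp add: z)
  next
    case 2
    obtain a b where "det a \<noteq> 0" "det b \<noteq> 0" "a ** mat2 1 0 0 0 ** b = x"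
      using rank_one_factorization[OF 2(2,1)] .
    then have "x \<in> orbit Sigma_grp (\<lambda>\<sigma>. \<sigma>) (mat2 1 0 0 0)" using o by blast
    moreover have "rank x = rank (mat2 1 0 0 0 :: 'k^2^2)"
      using 2 n d by (simp add: rank_mat2_eq_iff)
    ultimately show ?thesis by blast
  next
    case 3
    then have "x \<in> orbit Sigma_grp (\<lambda>\<sigma>. \<sigma>) (mat2 1 0 0 1)"
      using o[of x "mat 1" "mat 1"] by (simp add: i det_I)
    moreover have "rank x = rank (mat2 1 0 0 1 :: 'k^2^2)"
      using 3 n by (auto simp: rank_mat2_eq_iff det_2)
    ultimately show ?thesis by blast
  qed
qed

lemma orbit_eq_iff_rank_eq:
  fixes x y :: "'k::field^2^2"
  assumes two: "(2::'k) \<noteq> 0"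
  shows "orbit Sigma_grp (\<lambda>\<sigma>. \<sigma>) x = orbit Sigma_grp (\<lambda>\<sigma>. \<sigma>) y \<longleftrightarrow> rank x = rank y"
proof -
  interpret group_action "Sigma_grp" "UNIV :: ('k^2^2) set" "\<lambda>\<sigma>. \<sigma>" by (rule Sigma_grp_action)
  let ?O = "orbit Sigma_grp (\<lambda>\<sigma>. \<sigma>) :: 'k^2^2 \<Rightarrow> _"
  have inv: "rank z = rank x" if "z \<in> ?O x" for x z
    using that Sigma_beta_eq_0_iff Sigma_beta_det_eq_0_iff[OF two]
    by (auto simp: rank_mat2_eq_iff orbit_def Sigma_grp_def)
  have eq: "?O x = ?O y" if "x \<in> ?O y" for x y
    using that orbit_sym[of y x] orbit_trans by blast
  show ?thesis
  proof
    assume "?O x = ?O y"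
    then show "rank x = rank y" using orbit_refl[of x] inv by blast
  next
    assume r: "rank x = rank y"
    have reps: "t = u" if "rank t = rank u" "t \<in> {mat2 0 0 0 0, mat2 1 0 0 0, mat2 1 0 0 1}"
        "u \<in> {mat2 0 0 0 0, mat2 1 0 0 0, mat2 1 0 0 1}" for t u :: "'k^2^2"
      using that by (auto simp: rank_mat2_eq_iff mat2_entry)
    obtain t where t: "t \<in> {mat2 0 0 0 0, mat2 1 0 0 0, mat2 1 0 0 1}" "rank x = rank t" "x \<in> ?O t"
      using ex_rank_rep[OF two] by blast
    obtain u where u: "u \<in> {mat2 0 0 0 0, mat2 1 0 0 0, mat2 1 0 0 1}" "rank y = rank u" "y \<in> ?O u"
      using ex_rank_rep[OF two] by blast
    have "t = u" using reps t u r by metis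
    then show "?O x = ?O y" using eq t u by metis
  qed
qed

section \<open>Elements of \<open>Sigma_beta\<close> fixing the identity matrix\<close>

lemma Sigma_beta_fix_one_pure:
  fixes x :: "'k::field^2^2"
  assumes two: "(2::'k) \<noteq> 0" and \<tau>: "\<tau> \<in> Sigma_beta" "\<tau> (mat 1) = mat 1" and x: "x \<in> pure"
  shows "\<tau> x \<in> pure"
proof -
  interpret Vector_Spaces.linear "(*m)" "(*m)" \<tau> by (rule Sigma_beta_linear[OF \<tau>(1)])
  have unit: "\<tau> x \<in> pure" if x: "x \<in> pure" "det x = -1" for x
  proof -
    \<comment> \<open>Both determinants equal \<open>det x + 1\<close>, since the trace
      vanishes.\<close>
    have "det (x + mat 1) = 0" "det (x - mat 1) = 0"
      using x unfolding pure_22 by (simp_all add: mat2_entry algebra_simps)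
    then have "det (\<tau> x + mat 1) = 0" "det (\<tau> x - mat 1) = 0"
      using Sigma_beta_det_eq_0_iff[OF two \<tau>(1)] \<tau>(2) by (metis add, metis diff)
    then have "det (\<tau> x + mat 1) - det (\<tau> x - mat 1) = 0" by simp
    also have "det (\<tau> x + mat 1) - det (\<tau> x - mat 1) = 2 * trace (\<tau> x)"
      by (simp add: mat2_entry trace_2 algebra_simps)
    finally show ?thesis using two by (simp add: pure_def)
  qed
  define p q r where "p = x$1$1" and "q = x$1$2" and "r = x$2$1"
  \<comment> \<open>A basis of \<open>pure\<close> in determinant -1; \<open>C\<close> stands in for
    the nilpotent unit \<open>C - A\<close>.\<close>
  define A B C :: "'k^2^2" where "A = mat2 1 0 0 (-1)" and "B = mat2 0 1 1 0" and "C = mat2 1 1 0 (-1)"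
  have abc: "\<tau> A \<in> pure" "\<tau> B \<in> pure" "\<tau> C \<in> pure"
    by (rule unit; simp add: A_def B_def C_def pure_22 det_2)+
  have "x = r *m B + ((q - r) *m C + (p - (q - r)) *m A)"
    using x unfolding pure_22
    by (simp add: mat2_entry p_def q_def r_def A_def B_def C_def algebra_simps)
  then have "\<tau> x = r *m \<tau> B + ((q - r) *m \<tau> C + (p - (q - r)) *m \<tau> A)"
    by (simp only: add scale)
  then show ?thesis using abc by (simp add: pure_add pure_scale)
qed

text \<open>A pure \<open>x\<close> is \<open>beta (mat 1) (inverse 2 *m x)\<close>; applying the
  induced map gives the same expression in \<open>\<tau> x\<close>, which is again pure.\<close>

lemma induced_fix_one:
  fixes x :: "'k::field^2^2"
  assumes two: "(2::'k) \<noteq> 0" and \<tau>: "\<tau> \<in> Sigma_beta" "\<tau> (mat 1) = mat 1" and x: "x \<in> pure"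
  shows "induced \<tau> x = \<tau> x"
proof -
  interpret Vector_Spaces.linear "(*m)" "(*m)" \<tau> by (rule Sigma_beta_linear[OF \<tau>(1)])
  have "induced \<tau> x = beta (mat 1) (inverse 2 *m \<tau> x)"
    using induced(2)[OF two \<tau>(1), of "mat 1" "inverse 2 *m x"] x \<tau>(2)
    by (simp only: beta_one_half[OF two] scale)
  then show ?thesis using beta_one_half[OF two] Sigma_beta_fix_one_pure[OF assms] by simp
qed

text \<open>On \<open>pure\<close>, \<open>beta x\<close> is minus the commutator with
  \<open>x\<close>, and \<open>x ** x\<close> is the scalar \<open>- det x\<close>. The identity
  recovers \<open>det x\<close> from \<open>beta\<close>.\<close>

lemma beta_triple:
  fixes x :: "'k::field^2^2"
  assumes "x \<in> pure" "y \<in> pure"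
  shows "beta x (beta x (beta x y)) = (- 4 * det x) *m beta x y"
  using assms unfolding pure_22 by (simp add: mat2_entry algebra_simps)

lemma Sigma_beta_fix_one_det:
  fixes x :: "'k::field^2^2"
  assumes two: "(2::'k) \<noteq> 0" and \<tau>: "\<tau> \<in> Sigma_beta" "\<tau> (mat 1) = mat 1" and x: "x \<in> pure"
  shows "det (\<tau> x) = det x"
proof (cases "x = 0")
  case True
  then show ?thesis using Sigma_beta_eq_0_iff[OF \<tau>(1)] by metis
next
  case False
  interpret Vector_Spaces.linear "(*m)" "(*m)" \<tau> by (rule Sigma_beta_linear[OF \<tau>(1)])
  note p = Sigma_beta_fix_one_pure[OF two \<tau>]
  \<comment> \<open>On \<open>pure\<close> the induced map is \<open>\<tau>\<close> itself, so
    \<open>\<tau>\<close> is compatible with \<open>beta\<close>.\<close>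
  have hom: "\<tau> (beta u v) = beta (\<tau> u) (\<tau> v)" for u v
    using induced_fix_one[OF two \<tau> beta_in_pure] induced(2)[OF two \<tau>(1)] by metis
  \<comment> \<open>A partner not commuting with \<open>x\<close>, so that the scalars in front of
    \<open>\<tau> (beta x y)\<close> can be compared.\<close>
  obtain y where y: "y \<in> pure" "beta x y \<noteq> 0"
  proof (cases "x$2$1 = 0 \<and> x$1$1 = 0")
    case True
    then show ?thesis using False x two
      by (intro that[of "mat2 1 0 0 (-1)"]) (auto simp: pure_22 mat2_entry simp flip: mult_2)
  next
    case f: False
    then show ?thesis using False x two
      by (intro that[of "mat2 0 1 0 0"]) (auto simp: pure_22 mat2_entry simp flip: mult_2)
  qed
  have "(- 4 * det (\<tau> x)) *m \<tau> (beta x y) = \<tau> (beta x (beta x (beta x y)))"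
    using beta_triple[OF p[OF x] p[OF y(1)]] by (simp add: hom)
  also have "\<dots> = (- 4 * det x) *m \<tau> (beta x y)"
    unfolding beta_triple[OF x y(1)] by (rule scale)
  finally have "- 4 * det (\<tau> x) = - 4 * det x"
    using y(2) Sigma_beta_eq_0_iff[OF \<tau>(1)] mats.scale_right_imp_eq by blast
  moreover have "(- 4 :: 'k) = - (2 * 2)" by simp
  ultimately show ?thesis using two by (metis mult_cancel_left neg_equal_0_iff_equal mult_eq_0_iff)
qed

section \<open>Orbits on \<open>pure\<close>\<close>

text \<open>The clause about \<open>0\<close> separates the zero matrix from the nonzero nilpotents,
  which share its determinant.\<close>

lemma mem_conj_class_iff_det:
  fixes x :: "'k::field^2^2"
  assumes two: "(2::'k) \<noteq> 0" and x: "x \<in> pure"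
  shows "y \<in> conj_class x \<longleftrightarrow> y \<in> pure \<and> (y = 0 \<longleftrightarrow> x = 0) \<and> det y = det x"
proof
  assume "y \<in> conj_class x"
  then obtain g where g: "det g \<noteq> 0" "y = inverse (det g) *m (g ** x ** adj2 g)"
    by (auto simp: conj_class_adj2)
  have "adj2 g ** y ** g = det g *m x"
    using adj2_conj_adj2[of "adj2 g" x] g by (simp add: mat_scale_mult power2_eq_square)
  then have "y = 0 \<longleftrightarrow> x = 0" using g by auto
  moreover have "y \<in> pure" using g x pure_adj2_conj[of x "adj2 g"] by (simp add: pure_scale)
  moreover have "det y = det x"
    using g by (simp add: det_scale2 det_mul field_simps power2_eq_square)
  ultimately show "y \<in> pure \<and> (y = 0 \<longleftrightarrow> x = 0) \<and> det y = det x" by blast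
next
  assume y: "y \<in> pure \<and> (y = 0 \<longleftrightarrow> x = 0) \<and> det y = det x"
  show "y \<in> conj_class x"
  proof (cases "x = 0")
    case True
    then show ?thesis using y unfolding conj_class_adj2 by (auto intro!: exI[of _ "mat 1"])
  next
    case False
    then show ?thesis using y x conj_class_eq_det[OF two x] by blast
  qed
qed

lemma orbit_induced:
  fixes x :: "'k::field^2^2"
  assumes two: "(2::'k) \<noteq> 0" and x: "x \<in> pure"
  shows "orbit Sigma_grp induced x = (\<Union>c \<in> - {0}. (*m) c ` conj_class x)"
proof
  show "orbit Sigma_grp induced x \<subseteq> (\<Union>c \<in> - {0}. (*m) c ` conj_class x)"
  proof
    fix y assume "y \<in> orbit Sigma_grp induced x"
    then obtain \<sigma> where \<sigma>: "\<sigma> \<in> Sigma_beta" "y = induced \<sigma> x"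
      by (auto simp: orbit_def Sigma_grp_def)
    define a where "a = \<sigma> (mat 1)"
    have a: "det a \<noteq> 0" using Sigma_beta_det_eq_0_iff[OF two \<sigma>(1), of "mat 1"] by (simp add: a_def det_I)
    \<comment> \<open>\<open>b\<close> is the inverse of \<open>a\<close>, so left multiplication by
      \<open>b\<close> after \<open>\<sigma>\<close> fixes \<open>mat 1\<close>.\<close>
    define b where "b = inverse (det a) *m adj2 a"
    have b: "det b = inverse (det a)" using a by (simp add: b_def det_scale2 power2_eq_square)
    define \<tau> where "\<tau> = (\<lambda>x. b ** x ** mat 1) \<circ> \<sigma>"
    have \<tau>: "\<tau> \<in> Sigma_beta" unfolding \<tau>_def
      using a b by (intro Sigma_beta_comp two_sided_Sigma_beta(1)[OF two] \<sigma>) (simp_all add: det_I)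
    have one: "\<tau> (mat 1) = mat 1"
      using a by (simp add: \<tau>_def b_def mat_scale_mult adj2_mult_self flip: a_def)
    \<comment> \<open>Left multiplication by \<open>b\<close> scales \<open>beta\<close> by
      \<open>det b\<close>, and the values of \<open>beta\<close> exhaust
      \<open>pure\<close>.\<close>
    have "induced \<tau> x = det b *m y"
    proof -
      have adj1: "adj2 (mat 1) = (mat 1 :: 'k^2^2)" by (simp add: mat2_entry)
      have "induced \<tau> (beta u v) = det b *m induced \<sigma> (beta u v)" for u v
        unfolding induced(2)[OF two \<tau>] induced(2)[OF two \<sigma>(1)]
        using beta_mult[of b "\<sigma> u" "mat 1" "\<sigma> v"] by (simp add: \<tau>_def adj1)
      from this[of "mat 1" "inverse 2 *m x"] show ?thesis
        by (simp only: beta_one_half[OF two x] \<sigma>(2))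
    qed
    then have "y = det a *m \<tau> x"
      using a b induced_fix_one[OF two \<tau> one x] by simp
    moreover have "\<tau> x \<in> conj_class x"
      using mem_conj_class_iff_det[OF two x] Sigma_beta_fix_one_det[OF two \<tau> one x] Sigma_beta_eq_0_iff[OF \<tau>]
        Sigma_beta_fix_one_pure[OF two \<tau> one x] by blast
    ultimately show "y \<in> (\<Union>c \<in> - {0}. (*m) c ` conj_class x)" using a by blast
  qed
qed (rule scaled_conj_subset_orbit[OF assms])

text \<open>Scaling by \<open>c\<close> multiplies the determinant by \<open>c\<^sup>2\<close>; this
  reduces orbits to square classes, with the zero matrix kept apart.\<close>

lemma orbit_induced_det:
  fixes x :: "'k::field^2^2"
  assumes two: "(2::'k) \<noteq> 0" and x: "x \<in> pure"
  shows "y \<in> orbit Sigma_grp induced x \<longleftrightarrow>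
    y \<in> pure \<and> (y = 0 \<longleftrightarrow> x = 0) \<and> (\<exists>c. c \<noteq> 0 \<and> det y = c\<^sup>2 * det x)"
proof
  assume "y \<in> orbit Sigma_grp induced x"
  then obtain c z where "c \<noteq> 0" "z \<in> conj_class x" "y = c *m z"
    by (auto simp: orbit_induced[OF assms])
  then show "y \<in> pure \<and> (y = 0 \<longleftrightarrow> x = 0) \<and> (\<exists>c. c \<noteq> 0 \<and> det y = c\<^sup>2 * det x)"
    by (auto simp: mem_conj_class_iff_det[OF assms] pure_scale det_scale2)
next
  assume y: "y \<in> pure \<and> (y = 0 \<longleftrightarrow> x = 0) \<and> (\<exists>c. c \<noteq> 0 \<and> det y = c\<^sup>2 * det x)"
  then obtain c where c: "c \<noteq> 0" "det y = c\<^sup>2 * det x" by blast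
  then have "inverse c *m y \<in> conj_class x"
    using y by (auto simp: mem_conj_class_iff_det[OF assms] pure_scale det_scale2 field_simps)
  then have "c *m (inverse c *m y) \<in> (*m) c ` conj_class x" by blast
  then show "y \<in> orbit Sigma_grp induced x"
    using c by (auto simp: orbit_induced[OF assms])
qed

section \<open>Square classes and orbit representatives\<close>

text \<open>The extra element \<open>0\<close> serves \<open>a = 0\<close> only; for nonzero
  \<open>a\<close> the condition is membership in its square class.\<close>

lemma square_class_rep_unique:
  fixes R :: "'k::field set"
  assumes "square_class_reps R"
  shows "\<exists>!d. d \<in> R \<union> {0} \<and> (\<exists>c. c \<noteq> 0 \<and> d = c\<^sup>2 * a)"
proof (cases "a = 0")
  case True
  moreover have "\<exists>c::'k. c \<noteq> 0" by (rule exI[of _ 1]) simp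
  ultimately show ?thesis by auto
next
  case False
  have "d \<in> R \<union> {0} \<and> (\<exists>c. c \<noteq> 0 \<and> d = c\<^sup>2 * a) \<longleftrightarrow> d \<in> R \<and> d \<in> square_class a" for d
    using False by (auto simp: square_class_def mult.commute)
  then show ?thesis using assms False by (simp add: square_class_reps_def)
qed

text \<open>\<open>mat2 0 (- d) 1 0\<close> is nonzero, pure and of determinant \<open>d\<close>, so
  for \<open>x \<noteq> 0\<close> the claim is \<open>square_class_rep_unique\<close> at
  \<open>det x\<close>; \<open>d = 0\<close> stands for the nonzero nilpotents.\<close>

lemma ex1_rep_orbit_induced:
  fixes x :: "'k::field^2^2"
  assumes two: "(2::'k) \<noteq> 0" and R: "square_class_reps R" and x: "x \<in> pure"
  shows "\<exists>!t. t \<in> {mat2 0 0 0 0} \<union> {mat2 0 (- d) 1 0 | d. d \<in> R \<union> {0}} \<and> t \<in> orbit Sigma_grp induced x"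
proof (cases "x = 0")
  case True
  have "t \<in> orbit Sigma_grp induced x \<longleftrightarrow> t = mat2 0 0 0 0" for t
  proof -
    have z: "mat2 0 0 0 0 = (0 :: 'k^2^2)" by (simp add: mat2_entry)
    have "\<exists>c::'k. c \<noteq> 0" by (rule exI[of _ 1]) simp
    then show ?thesis
      unfolding orbit_induced_det[OF two x] z using True by (auto simp: pure_zero det_2)
  qed
  then show ?thesis by auto
next
  case False
  have C: "mat2 0 (- d) 1 0 \<in> orbit Sigma_grp induced x \<longleftrightarrow> (\<exists>c. c \<noteq> 0 \<and> d = c\<^sup>2 * det x)" for d
    unfolding orbit_induced_det[OF two x] using False by (simp add: pure_22 det_2 vec_eq_iff forall_2)
  have Z: "mat2 0 0 0 0 \<notin> orbit Sigma_grp induced x"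
  proof -
    have "mat2 0 0 0 0 = (0 :: 'k^2^2)" by (simp add: mat2_entry)
    then show ?thesis unfolding orbit_induced_det[OF two x] using False by simp
  qed
  obtain d where d: "d \<in> R \<union> {0}" "\<exists>c. c \<noteq> 0 \<and> d = c\<^sup>2 * det x"
    and u: "\<And>d'. d' \<in> R \<union> {0} \<Longrightarrow> \<exists>c. c \<noteq> 0 \<and> d' = c\<^sup>2 * det x \<Longrightarrow> d' = d"
    using square_class_rep_unique[OF R, of "det x"] by (elim ex1E) metis
  show ?thesis
  proof (rule ex1I[of _ "mat2 0 (- d) 1 0"])
    show "mat2 0 (- d) 1 0 \<in> {mat2 0 0 0 0} \<union> {mat2 0 (- d) 1 0 | d. d \<in> R \<union> {0}}
        \<and> mat2 0 (- d) 1 0 \<in> orbit Sigma_grp induced x"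
      using d(1) C[of d] d(2) by auto
  next
    fix t assume t: "t \<in> {mat2 0 0 0 0} \<union> {mat2 0 (- d) 1 0 | d. d \<in> R \<union> {0}}
      \<and> t \<in> orbit Sigma_grp induced x"
    then obtain d' where "d' \<in> R \<union> {0}" "t = mat2 0 (- d') 1 0" using Z by blast
    moreover have "\<exists>c. c \<noteq> 0 \<and> d' = c\<^sup>2 * det x"
      using t C[of d'] \<open>t = mat2 0 (- d') 1 0\<close> by simp
    ultimately show "t = mat2 0 (- d) 1 0" using u[of d'] by simp
  qed
qed

theorem theorem6p16:
  assumes "CHAR('k::field) \<noteq> 2"
  shows "card (orbits Sigma_grp (UNIV :: ('k^2^2) set) (\<lambda>\<sigma>. \<sigma>)) = 3
    \<and> (\<forall>x y :: 'k^2^2.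
          orbit Sigma_grp (\<lambda>\<sigma>. \<sigma>) x = orbit Sigma_grp (\<lambda>\<sigma>. \<sigma>) y \<longleftrightarrow> rank x = rank y)
    \<and> orbits Sigma_grp (UNIV :: ('k^2^2) set) (\<lambda>\<sigma>. \<sigma>)
        = orbit Sigma_grp (\<lambda>\<sigma>. \<sigma>) ` {mat2 0 0 0 0, mat2 1 0 0 0, mat2 1 0 0 1}
    \<and> (\<forall>x \<in> (pure :: ('k^2^2) set).
          orbit Sigma_grp induced x = (\<Union>c \<in> - {0}. (*m) c ` conj_class x))
    \<and> (\<forall>R :: 'k set. square_class_reps R \<longrightarrow>
          (let T = {mat2 0 0 0 0} \<union> {mat2 0 (- d) 1 0 | d. d \<in> R \<union> {0}} in
             T \<subseteq> pure \<and> (\<forall>X \<in> orbits Sigma_grp pure induced. \<exists>!t. t \<in> T \<and> t \<in> X)))"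
proof -
  have two: "(2::'k) \<noteq> 0" by (rule CHAR_neq_2_imp_two_neq_0[OF assms])
  let ?O = "orbit Sigma_grp (\<lambda>\<sigma>. \<sigma>) :: 'k^2^2 \<Rightarrow> _"
  let ?reps = "{mat2 0 0 0 0, mat2 1 0 0 0, mat2 1 0 0 1} :: ('k^2^2) set"
  note eq = orbit_eq_iff_rank_eq[OF two]
  have reps: "orbits Sigma_grp UNIV (\<lambda>\<sigma>. \<sigma>) = ?O ` ?reps"
  proof
    show "orbits Sigma_grp UNIV (\<lambda>\<sigma>. \<sigma>) \<subseteq> ?O ` ?reps"
    proof
      fix X assume "X \<in> orbits Sigma_grp (UNIV :: ('k^2^2) set) (\<lambda>\<sigma>. \<sigma>)"
      then obtain x where x: "X = ?O x" by (auto simp: orbits_def)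
      obtain t where "t \<in> ?reps" "rank x = rank t" using ex_rank_rep[OF two, of x] by blast
      then show "X \<in> ?O ` ?reps" unfolding x using eq by blast
    qed
  qed (auto simp: orbits_def)
  \<comment> \<open>The representatives have ranks 0, 1 and 2, so their orbits differ.\<close>
  have "inj_on ?O ?reps"
    unfolding inj_on_def eq by (auto simp: rank_mat2_eq_iff mat2_entry)
  then have "card (?O ` ?reps) = card ?reps" by (rule card_image)
  also have "card ?reps = 3" by (simp add: vec_eq_iff forall_2)
  finally have card: "card (?O ` ?reps) = 3" .
  have T: "{mat2 0 0 0 0} \<union> {mat2 0 (- d) 1 0 | d. d \<in> R \<union> {0}} \<subseteq> pure" for R :: "'k set"
    by (auto simp: pure_22)
  have ex1: "\<exists>!t. t \<in> {mat2 0 0 0 0} \<union> {mat2 0 (- d) 1 0 | d. d \<in> R \<union> {0}} \<and> t \<in> X"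
    if R: "square_class_reps R" and X: "X \<in> orbits Sigma_grp pure induced" for R :: "'k set" and X
  proof -
    obtain x where "x \<in> pure" "X = orbit Sigma_grp induced x" using X by (auto simp: orbits_def)
    then show ?thesis using ex1_rep_orbit_induced[OF two R] by blast
  qed
  show ?thesis
    unfolding Let_def reps card using eq orbit_induced[OF two] T ex1 by simp
qed

end
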